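(* Let $N\ge 1$, $\beta>0$, $\mathbf Y\in\mathbb C^{3N\times 3N}$, $\mathbf u\in\mathbb R^{3N}$ and limit vectors $\overline{\mathbf p},\underline{\mathbf p},\overline{\mathbf q},\underline{\mathbf q},\overline{\mathbf v},\underline{\mathbf v}\in\mathbb R^{3N}$ be given, and let $\mathbf C,\mathcal A,\mathcal B,\mathbf m(\mathbf u),\mathbf M_1,\mathbf H,\mathcal X,\phi$ be as defined in the context. Suppose that the primal semidefinite program $$\min_{\mathbf W\in\mathbb H^{3N},\ \mathbf z\in\mathbb R^{18N}}\ \beta\,\mathbf 1^\top\mathbf z+\operatorname{tr}(\mathbf C\mathbf W)\quad\text{s.t.}\quad \mathbf W\succeq 0,\ \ \mathbf z\ge \mathbf 0,\ \ \mathcal A(\mathbf W)+\mathbf m(\mathbf u)\le \mathbf z,\ \ \mathcal B(\mathbf W)=\mathbf M_1$$ has a unique optimal matrix solution $\mathbf W^\star$. Then, for every real number $\alpha>\operatorname{tr}(\mathbf W^\star)$, the set of optimal solutions $(\mathbf y,\bm\Gamma)$ of the dual semidefinite program $$\min_{\mathbf y\in\mathbb R^{18N},\ \bm\Gamma\in\mathbb H^3}\ -\mathbf m(\mathbf u)^\top\mathbf y+\operatorname{tr}(\bm\Gamma\mathbf M_1)\quad\text{s.t.}\quad \mathbf 0\le\mathbf y\le\beta\mathbf 1,\ \ \mathbf H(\mathbf y,\bm\Gamma)\succeq 0$$ equals the set of optimal solutions of the penalized problem $$\min_{(\mathbf y,\bm\Gamma)\in\mathcal X}\ f(\mathbf y,\bm\Gamma):=-\mathbf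 m(\mathbf u)^\top\mathbf y+\operatorname{tr}(\bm\Gamma\mathbf M_1)+\alpha\,\phi(\mathbf y,\bm\Gamma).$$
   Context: $\mathbb H^{n}$ is the real vector space of Hermitian matrices in $\mathbb C^{n\times n}$, with inner product $\langle \mathbf X,\mathbf Z\rangle=\operatorname{tr}(\mathbf X\mathbf Z)$; $\mathbf 1$ is the all-ones vector; vector inequalities are componentwise; $\operatorname{diag}(\cdot)$ extracts the diagonal of a square matrix as a vector; $\operatorname{Re},\operatorname{Im}$ are taken entrywise; $\mathsf H$ is conjugate transpose. $\mathbf Y$ is the admittance matrix of an $N$-bus three-phase network, and $\mathbf C:=\tfrac12(\mathbf Y+\mathbf Y^{\mathsf H})\in\mathbb H^{3N}$. The linear map $\mathcal A:\mathbb H^{3N}\to\mathbb R^{18N}$ is, with $\mathbf P:=\operatorname{diag}(\mathbf W\mathbf Y^{\mathsf H})\in\mathbb C^{3N}$, the stacked vector $$\mathcal A(\mathbf W):=\bigl[\operatorname{Re}(\mathbf P),\,-\operatorname{Re}(\mathbf P),\,\operatorname{Im}(\mathbf P),\,-\operatorname{Im}(\mathbf P),\,\operatorname{diag}(\mathbf W),\,-\operatorname{diag}(\mathbf W)\bigr]^\top .$$ The vector $\mathbf m(\mathbf u)\in\mathbb R^{18N}$ is the stacked vector $$\mathbf m(\mathbf u):=\bigl[-\mathbf u-\overline{\mathbf p},\ \mathbf u+\underline{\mathbf p},\ -\overline{\mathbf q},\ \underline{\mathbf q},\ -\overline{\mathbf v},\ \underline{\mathbf v}\bigr]^\top .$$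 The linear map $\mathcal B:\mathbb H^{3N}\to\mathbb H^3$ extracts the top-left $3\times3$ block, $\mathcal B(\mathbf W):=[\mathbf W]_{11}$. Let $\mathbf V_1:=[1,e^{-\mathrm i 2\pi/3},e^{\mathrm i2\pi/3}]^\top\in\mathbb C^3$ and $\mathbf M_1:=\mathbf V_1\mathbf V_1^{\mathsf H}$. $\mathcal A^*:\mathbb R^{18N}\to\mathbb H^{3N}$ and $\mathcal B^*:\mathbb H^3\to\mathbb H^{3N}$ are the adjoints: $\operatorname{tr}(\mathcal A^*(\mathbf y)\mathbf W)=\mathbf y^\top\mathcal A(\mathbf W)$ and $\operatorname{tr}(\mathcal B^*(\bm\Gamma)\mathbf W)=\operatorname{tr}(\bm\Gamma\,\mathcal B(\mathbf W))$; thus $\mathcal B^*(\bm\Gamma)$ has $\bm\Gamma$ in its top-left $3\times 3$ block and zeros elsewhere. Define $$\mathbf H(\mathbf y,\bm\Gamma):=\mathbf C+\mathcal A^*(\mathbf y)+\mathcal B^*(\bm\Gamma)\in\mathbb H^{3N},$$ $$\mathcal X:=\{(\mathbf y,\bm\Gamma)\in\mathbb R^{18N}\times\mathbb H^3:\ \mathbf 0\le\mathbf y\le\beta\mathbf 1\},\qquad \phi(\mathbf y,\bm\Gamma):=\max\{\lambda_{\max}(-\mathbf H(\mathbf y,\bm\Gamma)),\,0\},$$ where $\lambda_{\max}$ is the largest eigenvalue. "Unique optimal matrix solution $\mathbf W^\star$" means that an optimal pair $(\mathbf W,\mathbf z)$ of the primal exists and every optimal pair has $\mathbf W=\mathbf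 W^\star$. *)

theory Defs
  imports "HOL-Analysis.Analysis"
begin

section \<open>Hermitian matrices\<close>

definition conj_transpose :: "complex^'m^'n \<Rightarrow> complex^'n^'m" where
  "conj_transpose A = (\<chi> i j. cnj (A $ j $ i))"

definition hermitian :: "complex^'k^'k \<Rightarrow> bool" where
  "hermitian A \<longleftrightarrow> conj_transpose A = A"

definition trace_inner :: "complex^'k^'k \<Rightarrow> complex^'k^'k \<Rightarrow> real" where
  \<comment> \<open>The trace of a product of two Hermitian matrices is real; \<open>Re\<close> only changes the type.\<close>
  "trace_inner X Z = Re (trace (X ** Z))"

definition psd :: "complex^'k^'k \<Rightarrow> bool" where
  "psd A \<longleftrightarrow> hermitian A \<and> (\<forall>x. 0 \<le> Re (\<Sum>i\<in>UNIV. cnj (x $ i) * (A *v x) $ i))"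

definition outer :: "complex^'k \<Rightarrow> complex^'k^'k" where
  "outer v = (\<chi> i j. v $ i * cnj (v $ j))"

definition diagonal :: "'a^'k^'k \<Rightarrow> 'a^'k" where
  "diagonal A = (\<chi> i. A $ i $ i)"

definition vec_Re :: "complex^'k \<Rightarrow> real^'k" where
  "vec_Re v = (\<chi> i. Re (v $ i))"

definition vec_Im :: "complex^'k \<Rightarrow> real^'k" where
  "vec_Im v = (\<chi> i. Im (v $ i))"

text \<open>Every Hermitian matrix has a largest eigenvalue and all its eigenvalues are real;
  \<open>lambda_max\<close> is meant for Hermitian arguments only.\<close>

definition lambda_max :: "complex^'k^'k \<Rightarrow> real" where
  "lambda_max A = (GREATEST l::real. \<exists>v. v \<noteq> 0 \<and> A *v v = complex_of_real l *s v)"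

text \<open>The Hermitian matrix representing a real-linear functional on the space of Hermitian
  matrices with respect to the trace inner product. Both adjoint maps below are defined by it;
  lemma \<open>hermitian_riesz\<close> shows that it exists and is unique.\<close>

definition hermitian_rep :: "(complex^'k^'k \<Rightarrow> real) \<Rightarrow> complex^'k^'k" where
  "hermitian_rep \<phi> =
    (THE S. hermitian S \<and> (\<forall>W. hermitian W \<longrightarrow> trace_inner S W = \<phi> W))"

lemma trace_inner_eq_inner:
  assumes "hermitian S"
  shows "trace_inner S W = S \<bullet> W"
proof -
  have *: "S $ i $ j = cnj (S $ j $ i)" for i j
  proof -
    have "S $ i $ j = conj_transpose S $ i $ j"
      using assms by (simp add: hermitian_def)
    then show ?thesis by (simp add: conj_transpose_def)
  qed
  have "trace_inner S W = (\<Sum>i\<in>UNIV. \<Sum>j\<in>UNIV. Re (S $ i $ j * W $ j $ i))"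
    by (simp add: trace_inner_def trace_def matrix_matrix_mult_def)
  also have "\<dots> = (\<Sum>i\<in>UNIV. \<Sum>j\<in>UNIV. (S $ j $ i) \<bullet> (W $ j $ i))"
  proof (intro sum.cong refl)
    fix i j
    show "Re (S $ i $ j * W $ j $ i) = (S $ j $ i) \<bullet> (W $ j $ i)"
      using *[of i j] by (simp add: inner_complex_def)
  qed
  also have "\<dots> = (\<Sum>j\<in>UNIV. \<Sum>i\<in>UNIV. (S $ j $ i) \<bullet> (W $ j $ i))"
    by (rule sum.swap)
  also have "\<dots> = S \<bullet> W"
    by (simp add: inner_vec_def)
  finally show ?thesis .
qed

lemma inner_conj_transpose: "conj_transpose S \<bullet> W = S \<bullet> conj_transpose W"
proof -
  have "conj_transpose S \<bullet> W = (\<Sum>i\<in>UNIV. \<Sum>j\<in>UNIV. cnj (S $ j $ i) \<bullet> (W $ i $ j))"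
    by (simp add: inner_vec_def conj_transpose_def)
  also have "\<dots> = (\<Sum>j\<in>UNIV. \<Sum>i\<in>UNIV. cnj (S $ j $ i) \<bullet> (W $ i $ j))"
    by (rule sum.swap)
  also have "\<dots> = S \<bullet> conj_transpose W"
    by (simp add: inner_vec_def conj_transpose_def inner_complex_def)
  finally show ?thesis .
qed

lemma hermitian_riesz:
  fixes \<phi> :: "complex^'k^'k \<Rightarrow> real"
  assumes "linear \<phi>"
  shows "\<exists>!S. hermitian S \<and> (\<forall>W. hermitian W \<longrightarrow> trace_inner S W = \<phi> W)"
proof (rule ex_ex1I)
  define R where "R = adjoint \<phi> 1"
  define S where "S = (1/2) *\<^sub>R (R + conj_transpose R)"
  have R: "R \<bullet> W = \<phi> W" for W
    using adjoint_works[OF assms] by (simp add: R_def inner_commute)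
  have S: "hermitian S"
    by (simp add: S_def hermitian_def conj_transpose_def vec_eq_iff add.commute)
  moreover have "trace_inner S W = \<phi> W" if "hermitian W" for W
    using that unfolding trace_inner_eq_inner[OF S]
    by (simp add: S_def inner_add_left inner_conj_transpose hermitian_def R)
  ultimately show "\<exists>S. hermitian S \<and> (\<forall>W. hermitian W \<longrightarrow> trace_inner S W = \<phi> W)"
    by blast
next
  fix S T
  assume S: "hermitian S \<and> (\<forall>W. hermitian W \<longrightarrow> trace_inner S W = \<phi> W)"
    and T: "hermitian T \<and> (\<forall>W. hermitian W \<longrightarrow> trace_inner T W = \<phi> W)"
  have ST: "hermitian (S - T)"
    using S T by (simp add: hermitian_def conj_transpose_def vec_eq_iff)
  then have "S \<bullet> (S - T) = T \<bullet> (S - T)"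
    using S T trace_inner_eq_inner by metis
  then have "(S - T) \<bullet> (S - T) = 0"
    by (simp add: inner_diff_left)
  then show "S = T" by simp
qed

lemma hermitian_rep:
  assumes "linear \<phi>"
  shows "hermitian (hermitian_rep \<phi>)"
    and "hermitian W \<Longrightarrow> trace_inner (hermitian_rep \<phi>) W = \<phi> W"
  using theI'[OF hermitian_riesz[OF assms]] unfolding hermitian_rep_def by blast+

section \<open>The network problem\<close>

text \<open>The finite type \<open>'n\<close> is the set of the \<open>N\<close> buses, the numeral type \<open>3\<close> the set of
  phases. A vector in \<open>\<complex>\<^sup>3\<^sup>N\<close> is indexed by pairs (bus, phase), and a vector in \<open>\<real>\<^sup>1\<^sup>8\<^sup>N\<close>
  is a stack of six blocks in \<open>\<real>\<^sup>3\<^sup>N\<close>. Order, inner product and the vector \<open>1\<close> on the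
  latter type are the componentwise ones. The first bus is the parameter \<open>s\<close>, and the top-left
  block of a matrix is the block with both bus indices equal to \<open>s\<close>.\<close>

type_synonym 'n cmat = "complex^('n \<times> 3)^('n \<times> 3)"
type_synonym 'n rvec = "real^('n \<times> 3)"
type_synonym 'n stack = "real^('n \<times> 3)^6"

definition C_mat :: "'n::finite cmat \<Rightarrow> 'n cmat" where
  "C_mat Y = (1/2) *\<^sub>R (Y + conj_transpose Y)"

definition power_vec :: "'n::finite cmat \<Rightarrow> 'n cmat \<Rightarrow> complex^('n \<times> 3)" where
  "power_vec Y W = diagonal (W ** conj_transpose Y)"

definition A_map :: "'n::finite cmat \<Rightarrow> 'n cmat \<Rightarrow> 'n stack" where
  "A_map Y W = vector
    [vec_Re (power_vec Y W), - vec_Re (power_vec Y W),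
     vec_Im (power_vec Y W), - vec_Im (power_vec Y W),
     vec_Re (diagonal W), - vec_Re (diagonal W)]"

definition m_vec :: "'n rvec \<Rightarrow> 'n rvec \<Rightarrow> 'n rvec \<Rightarrow> 'n rvec \<Rightarrow> 'n rvec
    \<Rightarrow> 'n rvec \<Rightarrow> 'n::finite rvec \<Rightarrow> 'n stack" where
  "m_vec p_max p_min q_max q_min v_max v_min u =
    vector [- u - p_max, u + p_min, - q_max, q_min, - v_max, v_min]"

definition B_map :: "'n::finite \<Rightarrow> 'n cmat \<Rightarrow> complex^3^3" where
  "B_map s W = (\<chi> a b. W $ (s, a) $ (s, b))"

definition V1 :: "complex^3" where
  "V1 = vector [1, exp (- \<i> * complex_of_real (2 * pi / 3)),
    exp (\<i> * complex_of_real (2 * pi / 3))]"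

definition M1 :: "complex^3^3" where
  "M1 = outer V1"

definition A_adj :: "'n::finite cmat \<Rightarrow> 'n stack \<Rightarrow> 'n cmat" where
  "A_adj Y y = hermitian_rep (\<lambda>W. y \<bullet> A_map Y W)"

definition B_adj :: "'n::finite \<Rightarrow> complex^3^3 \<Rightarrow> 'n cmat" where
  "B_adj s \<Gamma> = hermitian_rep (\<lambda>W. trace_inner \<Gamma> (B_map s W))"

definition H_mat :: "'n::finite \<Rightarrow> 'n cmat \<Rightarrow> 'n stack \<Rightarrow> complex^3^3 \<Rightarrow> 'n cmat" where
  "H_mat s Y y \<Gamma> = C_mat Y + A_adj Y y + B_adj s \<Gamma>"

definition primal_feasible ::
    "'n::finite \<Rightarrow> 'n cmat \<Rightarrow> 'n stack \<Rightarrow> 'n cmat \<times> 'n stack \<Rightarrow> bool" where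
  "primal_feasible s Y m = (\<lambda>(W, z).
    psd W \<and> 0 \<le> z \<and> A_map Y W + m \<le> z \<and> B_map s W = M1)"

definition primal_obj ::
    "real \<Rightarrow> 'n::finite cmat \<Rightarrow> 'n cmat \<times> 'n stack \<Rightarrow> real" where
  "primal_obj \<beta> Y = (\<lambda>(W, z). \<beta> * (1 \<bullet> z) + trace_inner (C_mat Y) W)"

definition unique_primal_solution ::
    "'n::finite \<Rightarrow> real \<Rightarrow> 'n cmat \<Rightarrow> 'n stack \<Rightarrow> 'n cmat \<Rightarrow> bool" where
  "unique_primal_solution s \<beta> Y m W' \<longleftrightarrow>
    (\<exists>z. is_arg_min (primal_obj \<beta> Y) (primal_feasible s Y m) (W', z)) \<and>
    (\<forall>W z. is_arg_min (primal_obj \<beta> Y) (primal_feasible s Y m) (W, z) \<longrightarrow> W = W')"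

definition X_set :: "real \<Rightarrow> ('n::finite stack \<times> (complex^3^3)) set" where
  "X_set \<beta> = {(y, \<Gamma>). hermitian \<Gamma> \<and> 0 \<le> y \<and> y \<le> \<beta> *\<^sub>R 1}"

definition dual_feasible ::
    "'n::finite \<Rightarrow> real \<Rightarrow> 'n cmat \<Rightarrow> 'n stack \<times> (complex^3^3) \<Rightarrow> bool" where
  "dual_feasible s \<beta> Y = (\<lambda>(y, \<Gamma>).
    hermitian \<Gamma> \<and> 0 \<le> y \<and> y \<le> \<beta> *\<^sub>R 1 \<and> psd (H_mat s Y y \<Gamma>))"

definition dual_obj :: "'n::finite stack \<Rightarrow> 'n stack \<times> (complex^3^3) \<Rightarrow> real" where
  "dual_obj m = (\<lambda>(y, \<Gamma>). - (m \<bullet> y) + trace_inner \<Gamma> M1)"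

definition phi :: "'n::finite \<Rightarrow> 'n cmat \<Rightarrow> 'n stack \<times> (complex^3^3) \<Rightarrow> real" where
  "phi s Y = (\<lambda>(y, \<Gamma>). max (lambda_max (- H_mat s Y y \<Gamma>)) 0)"

definition penalized_obj ::
    "'n::finite \<Rightarrow> 'n cmat \<Rightarrow> 'n stack \<Rightarrow> real \<Rightarrow> 'n stack \<times> (complex^3^3) \<Rightarrow> real" where
  "penalized_obj s Y m \<alpha> = (\<lambda>(y, \<Gamma>).
    - (m \<bullet> y) + trace_inner \<Gamma> M1 + \<alpha> * phi s Y (y, \<Gamma>))"

section \<open>Well-definedness of the encoding\<close>

lemma vector_6:
  fixes a b c d e f :: "'a::zero"
  shows "(vector [a, b, c, d, e, f] :: 'a^6) $ 1 = a"
    "(vector [a, b, c, d, e, f] :: 'a^6) $ 2 = b"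
    "(vector [a, b, c, d, e, f] :: 'a^6) $ 3 = c"
    "(vector [a, b, c, d, e, f] :: 'a^6) $ 4 = d"
    "(vector [a, b, c, d, e, f] :: 'a^6) $ 5 = e"
    "(vector [a, b, c, d, e, f] :: 'a^6) $ 6 = f"
  unfolding vector_def by simp_all

lemma UNIV_6: "(UNIV :: 6 set) = {1, 2, 3, 4, 5, 6}"
proof -
  have c: "card {1, 2, 3, 4, 5, 6 :: 6} = CARD(6)" by simp
  show ?thesis
    by (rule card_subset_eq[symmetric]) (simp_all only: c finite subset_UNIV)
qed

lemma linear_A_map:
  fixes Y :: "'n::finite cmat"
  shows "linear (A_map Y)"
proof -
  have 1: "power_vec Y (V + W) = power_vec Y V + power_vec Y W" for V W
    by (simp add: power_vec_def diagonal_def vec_eq_iff matrix_matrix_mult_def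
        distrib_right sum.distrib)
  have 2: "power_vec Y (c *\<^sub>R W) = c *\<^sub>R power_vec Y W" for c W
    by (simp add: power_vec_def diagonal_def vec_eq_iff matrix_matrix_mult_def
        scaleR_sum_right)
  have eq6: "v = w" if "v $ 1 = w $ 1" "v $ 2 = w $ 2" "v $ 3 = w $ 3"
      "v $ 4 = w $ 4" "v $ 5 = w $ 5" "v $ 6 = w $ 6" for v w :: "'n stack"
  proof -
    have "v $ i = w $ i" for i
      using UNIV_I[of i] that unfolding UNIV_6 by blast
    then show ?thesis by (simp add: vec_eq_iff)
  qed
  have 3: "vec_Re (v + w) = vec_Re v + vec_Re w" "vec_Im (v + w) = vec_Im v + vec_Im w"
    "vec_Re (c *\<^sub>R v) = c *\<^sub>R vec_Re v" "vec_Im (c *\<^sub>R v) = c *\<^sub>R vec_Im v"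
    for v w :: "complex^('n \<times> 3)" and c
    by (simp_all add: vec_Re_def vec_Im_def vec_eq_iff)
  have 4: "diagonal (V + W) = diagonal V + diagonal W" "diagonal (c *\<^sub>R W) = c *\<^sub>R diagonal W"
    for V W :: "'n cmat" and c
    by (simp_all add: diagonal_def vec_eq_iff)
  show ?thesis
  proof (rule linearI)
    show "A_map Y (V + W) = A_map Y V + A_map Y W" for V W
      by (rule eq6) (simp_all only: A_map_def vector_6 vector_add_component 1 3 4
        minus_add_distrib)
    show "A_map Y (c *\<^sub>R W) = c *\<^sub>R A_map Y W" for c W
      by (rule eq6) (simp_all only: A_map_def vector_6 vector_scaleR_component 2 3 4
        scaleR_minus_right)
  qed
qed

lemma A_adj:
  shows "hermitian (A_adj Y y)"
    and "hermitian W \<Longrightarrow> trace_inner (A_adj Y y) W = y \<bullet> A_map Y W"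
proof -
  have "linear (\<lambda>W. y \<bullet> A_map Y W)"
    using linear_A_map[of Y] by (simp add: linear_iff inner_add_right)
  from hermitian_rep[OF this] show "hermitian (A_adj Y y)"
    and "hermitian W \<Longrightarrow> trace_inner (A_adj Y y) W = y \<bullet> A_map Y W"
    unfolding A_adj_def by blast+
qed

lemma B_adj:
  assumes "hermitian \<Gamma>"
  shows "hermitian (B_adj s \<Gamma>)"
    and "hermitian W \<Longrightarrow> trace_inner (B_adj s \<Gamma>) W = trace_inner \<Gamma> (B_map s W)"
proof -
  have B: "B_map s (V + W) = B_map s V + B_map s W" "B_map s (c *\<^sub>R W) = c *\<^sub>R B_map s W"
    for V W c
    by (simp_all add: B_map_def vec_eq_iff)
  have "linear (\<lambda>W. trace_inner \<Gamma> (B_map s W))"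
    unfolding trace_inner_eq_inner[OF assms]
    by (rule linearI) (simp_all add: B inner_add_right)
  from hermitian_rep[OF this] show "hermitian (B_adj s \<Gamma>)"
    and "hermitian W \<Longrightarrow> trace_inner (B_adj s \<Gamma>) W = trace_inner \<Gamma> (B_map s W)"
    unfolding B_adj_def by blast+
qed

end

theory Submission
  imports Defs
begin

text \<open>Let \<open>p\<close> be the primal value. Pairing \<open>H(y, \<Gamma>)\<close> with the primal optimum \<open>W\<close> shows that the
  penalized objective is at least \<open>- p + (\<alpha> - tr W) \<phi>(y, \<Gamma>)\<close> on \<open>X\<close>. So once the dual infimum is
  known to be \<open>- p\<close>, attained or not, both problems have the infimum \<open>- p\<close> and every penalized
  minimizer satisfies \<open>\<phi> = 0\<close>, that is, dual feasibility.

  The primal problem is never strictly feasible when the rank one block \<open>M\<^sub>1\<close> is prescribed, so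
  Slater's condition cannot be applied to it. Uniqueness of \<open>W\<close> replaces it: the linear map that
  sends a primal point with slacks to its objective and constraint values has no nonzero kernel
  element in the cone of such points, hence the image of the cone is closed, and a point of this
  image space with a smaller objective value can be strictly separated from it.\<close>

section \<open>Positive semidefinite matrices\<close>

lemma Re_sum_cnj_mult: "Re (\<Sum>i\<in>UNIV. cnj (x $ i) * y $ i) = x \<bullet> y" for x y :: "complex^'k"
  by (simp add: inner_vec_def inner_complex_def)

lemma psd_iff_inner: "psd A \<longleftrightarrow> hermitian A \<and> (\<forall>x. 0 \<le> x \<bullet> (A *v x))"
  unfolding psd_def Re_sum_cnj_mult ..

lemma hermitian_nth: "hermitian A \<Longrightarrow> cnj (A $ j $ i) = A $ i $ j"
  by (simp add: hermitian_def conj_transpose_def vec_eq_iff)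

lemma hermitian_inner_matvec:
  assumes "hermitian A"
  shows "(A *v x) \<bullet> y = x \<bullet> (A *v y)"
proof -
  have "(A *v x) \<bullet> y = (\<Sum>i\<in>UNIV. \<Sum>j\<in>UNIV. (A $ i $ j * x $ j) \<bullet> y $ i)"
    by (simp add: inner_vec_def matrix_vector_mult_def inner_sum_left)
  also have "\<dots> = (\<Sum>j\<in>UNIV. \<Sum>i\<in>UNIV. (A $ i $ j * x $ j) \<bullet> y $ i)"
    by (rule sum.swap)
  also have "\<dots> = (\<Sum>j\<in>UNIV. \<Sum>i\<in>UNIV. x $ j \<bullet> (A $ j $ i * y $ i))"
  proof (intro sum.cong refl)
    fix i j
    show "(A $ i $ j * x $ j) \<bullet> y $ i = x $ j \<bullet> (A $ j $ i * y $ i)"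
      using hermitian_nth[OF assms, of i j, symmetric] by (simp add: inner_complex_def algebra_simps)
  qed
  also have "\<dots> = x \<bullet> (A *v y)"
    by (simp add: inner_vec_def matrix_vector_mult_def inner_sum_right)
  finally show ?thesis .
qed

text \<open>A quadratic form in \<open>x\<close> is a linear functional of the matrix. Positive
  semidefiniteness thus becomes a family of linear inequalities, which serves both closedness of the
  cone and the test for dual feasibility.\<close>

lemma inner_outer: "A \<bullet> outer x = x \<bullet> (A *v x)" for x :: "complex^'k"
proof -
  have "a \<bullet> (b * cnj c) = b \<bullet> (a * c)" for a b c :: complex
    by (simp add: inner_complex_def algebra_simps)
  then show ?thesis
    by (simp add: inner_vec_def matrix_vector_mult_def inner_sum_right outer_def)
qed

lemma of_real_smult: "complex_of_real r *s v = r *\<^sub>R v"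
  by (simp add: vec_eq_iff scaleR_conv_of_real[where 'a = complex])

lemma matvec_scaleR: "A *v (r *\<^sub>R x) = r *\<^sub>R (A *v x)" for A :: "complex^'k^'n"
  by (simp add: matrix_vector_mult_def vec_eq_iff scaleR_sum_right)

lemma scaleR_matvec: "(r *\<^sub>R A) *v x = r *\<^sub>R (A *v x)" for A :: "complex^'k^'n"
  by (simp add: matrix_vector_mult_def vec_eq_iff scaleR_sum_right)

lemma matvec_smult: "A *v (c *s x) = c *s (A *v x)" for A :: "complex^'k^'n"
  by (simp add: matrix_vector_mult_def vec_eq_iff sum_distrib_left algebra_simps)

lemma linear_matvec: "linear ((*v) A)" for A :: "complex^'k^'n"
  by (simp add: linear_iff matvec_scaleR matrix_vector_right_distrib)

lemma linear_conj_transpose: "linear conj_transpose"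
  by (simp add: linear_iff conj_transpose_def vec_eq_iff)

lemma hermitian_add: "hermitian A \<Longrightarrow> hermitian B \<Longrightarrow> hermitian (A + B)"
  by (simp add: hermitian_def linear_add[OF linear_conj_transpose])

lemma hermitian_diff: "hermitian A \<Longrightarrow> hermitian B \<Longrightarrow> hermitian (A - B)"
  by (simp add: hermitian_def linear_diff[OF linear_conj_transpose])

lemma hermitian_uminus: "hermitian A \<Longrightarrow> hermitian (- A)"
  by (simp add: hermitian_def linear_neg[OF linear_conj_transpose])

lemma hermitian_scaleR: "hermitian A \<Longrightarrow> hermitian (r *\<^sub>R A)"
  by (simp add: hermitian_def linear_scale[OF linear_conj_transpose])

lemma hermitian_outer: "hermitian (outer x)"
  by (simp add: hermitian_def conj_transpose_def outer_def vec_eq_iff)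

lemma hermitian_mat_1: "hermitian (mat 1)"
  by (simp add: hermitian_def conj_transpose_def mat_def vec_eq_iff)

lemma hermitian_part: "hermitian ((1/2) *\<^sub>R (A + conj_transpose A))"
  by (simp add: hermitian_def conj_transpose_def vec_eq_iff add.commute)

text \<open>Taking the Hermitian part is the orthogonal projection onto the Hermitian matrices. It
  allows a separating functional with an arbitrary matrix coefficient to be replaced by a Hermitian
  one.\<close>

lemma inner_hermitian_part:
  assumes "hermitian W"
  shows "((1/2) *\<^sub>R (A + conj_transpose A)) \<bullet> W = A \<bullet> W"
  using assms by (simp add: inner_add_left inner_conj_transpose hermitian_def)

lemma outer_matvec: "outer v *v x = (\<Sum>i\<in>UNIV. cnj (v $ i) * x $ i) *s v"
  unfolding vec_eq_iff
proof
  fix i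
  have "(outer v *v x) $ i = (\<Sum>j\<in>UNIV. cnj (v $ j) * x $ j * v $ i)"
    unfolding outer_def matrix_vector_mult_def vec_lambda_beta
    by (intro sum.cong refl) (simp add: mult_ac)
  then show "(outer v *v x) $ i = ((\<Sum>j\<in>UNIV. cnj (v $ j) * x $ j) *s v) $ i"
    by (simp only: vector_smult_component sum_distrib_right)
qed

lemma inner_smult: "u \<bullet> (a *s w) = Re (a * (\<Sum>i\<in>UNIV. cnj (u $ i) * w $ i))"
  for u w :: "complex^'k"
proof -
  have "u \<bullet> (a *s w) = Re (\<Sum>i\<in>UNIV. cnj (u $ i) * (a *s w) $ i)"
    by (rule Re_sum_cnj_mult[symmetric])
  also have "(\<Sum>i\<in>UNIV. cnj (u $ i) * (a *s w) $ i) = a * (\<Sum>i\<in>UNIV. cnj (u $ i) * w $ i)"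
    by (simp add: sum_distrib_left algebra_simps)
  finally show ?thesis .
qed

section \<open>The cone of positive semidefinite matrices and its pairing\<close>

lemma psd_add: "psd A \<Longrightarrow> psd B \<Longrightarrow> psd (A + B)"
  by (simp add: psd_iff_inner hermitian_add matrix_vector_mult_add_rdistrib inner_add_right)

lemma psd_scaleR: "psd A \<Longrightarrow> 0 \<le> r \<Longrightarrow> psd (r *\<^sub>R A)"
  by (simp add: psd_iff_inner hermitian_scaleR scaleR_matvec)

lemma psd_zero: "psd 0"
  by (simp add: psd_iff_inner hermitian_def linear_0[OF linear_conj_transpose])

lemma psd_outer: "psd (outer x)"
  unfolding psd_iff_inner
proof (intro conjI allI hermitian_outer)
  fix y
  define b where "b = (\<Sum>i\<in>UNIV. cnj (x $ i) * y $ i)"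
  have "(\<Sum>i\<in>UNIV. cnj (y $ i) * x $ i) = cnj b"
    by (simp add: b_def mult.commute)
  then have "y \<bullet> (outer x *v y) = Re (b * cnj b)"
    by (simp add: outer_matvec inner_smult b_def)
  then show "0 \<le> y \<bullet> (outer x *v y)" by simp
qed

text \<open>The form is nonnegative and so has a minimum at \<open>x\<close>; a small step from
  \<open>x\<close> against \<open>A *v x\<close> would make it negative if that vector were
  nonzero.\<close>

lemma psd_matvec_eq_0:
  assumes "psd A" and 0: "x \<bullet> (A *v x) = 0"
  shows "A *v x = 0"
proof (rule ccontr)
  assume "A *v x \<noteq> 0"
  define y where "y = A *v x"
  define a where "a = y \<bullet> y"
  define b where "b = y \<bullet> (A *v y)"
  have A: "hermitian A" "\<And>x. 0 \<le> x \<bullet> (A *v x)" using assms(1) by (auto simp: psd_iff_inner)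
  have a: "a > 0" using \<open>A *v x \<noteq> 0\<close> by (simp add: a_def y_def)
  have b: "b \<ge> 0" using A by (simp add: b_def)
  have *: "0 \<le> e\<^sup>2 * b - 2 * e * a" for e
  proof -
    have "0 \<le> (x - e *\<^sub>R y) \<bullet> (A *v (x - e *\<^sub>R y))" by (rule A)
    also have "A *v (x - e *\<^sub>R y) = y - e *\<^sub>R (A *v y)"
      by (simp add: linear_diff[OF linear_matvec] matvec_scaleR y_def)
    also have "(x - e *\<^sub>R y) \<bullet> (y - e *\<^sub>R (A *v y)) = e\<^sup>2 * b - 2 * e * a"
      using 0 hermitian_inner_matvec[OF A(1), of x y]
      by (simp add: inner_diff inner_diff_right a_def b_def algebra_simps power2_eq_square flip: y_def)
    finally show ?thesis .
  qed
  \<comment> \<open>The gain \<open>2 * e * a\<close> has to beat the second-order term, that is,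
    \<open>e * b < 2 * a\<close>. The summand 1 keeps the denominator positive when
    \<open>b = 0\<close>.\<close>
  define e where "e = a / (b + 1)"
  have e: "e > 0" using a b by (simp add: e_def)
  have "e * b \<le> a"
    using a b by (simp add: e_def field_simps)
  then have "e * b < 2 * a" using a by simp
  then have "e * (e * b) < e * (2 * a)" using e by simp
  with *[of e] show False by (simp add: power2_eq_square algebra_simps)
qed

text \<open>This is the Cauchy-Schwarz inequality for the semi-inner product of \<open>W\<close>:
  the new form at \<open>y\<close> is the form of \<open>W\<close> at \<open>y\<close> minus its
  projection onto \<open>x\<close>.\<close>

lemma psd_deflate:
  assumes "psd W" and q: "x \<bullet> (W *v x) > 0"
  shows "psd (W - (1 / (x \<bullet> (W *v x))) *\<^sub>R outer (W *v x))" (is "psd ?W'")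
  unfolding psd_iff_inner
proof (intro conjI allI)
  have W: "hermitian W" "\<And>x. 0 \<le> x \<bullet> (W *v x)" using assms(1) by (auto simp: psd_iff_inner)
  show "hermitian ?W'"
    by (intro hermitian_diff hermitian_scaleR hermitian_outer W)
  fix y
  define q where "q = x \<bullet> (W *v x)"
  have q0: "q > 0" using q by (simp add: q_def)
  define b where "b = (\<Sum>i\<in>UNIV. cnj ((W *v x) $ i) * y $ i)"
  \<comment> \<open>The coefficient of that projection: \<open>b\<close> is the product of
    \<open>x\<close> and \<open>y\<close> in the form of \<open>W\<close>, and \<open>q\<close> that
    of \<open>x\<close> with itself.\<close>
  define a where "a = b / complex_of_real q"
  have cb: "(\<Sum>i\<in>UNIV. cnj (y $ i) * (W *v x) $ i) = cnj b"
    by (simp add: b_def mult.commute)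
  have bb: "Re (b * cnj b) = (cmod b)\<^sup>2"
    by (simp add: complex_norm_square[symmetric])
  have ax: "W *v (a *s x) = a *s (W *v x)" by (rule matvec_smult)
  have 1: "y \<bullet> (W *v (a *s x)) = (cmod b)\<^sup>2 / q"
    unfolding ax inner_smult cb using bb by (simp add: a_def)
  have "(a *s x) \<bullet> (W *v (a *s x)) = Re (a * (cnj a * (\<Sum>i\<in>UNIV. cnj (x $ i) * (W *v x) $ i)))"
    unfolding ax inner_smult by (simp add: sum_distrib_left algebra_simps)
  also have "\<dots> = Re ((a * cnj a) * (\<Sum>i\<in>UNIV. cnj (x $ i) * (W *v x) $ i))"
    by (simp only: mult.assoc)
  also have "\<dots> = (cmod a)\<^sup>2 * q"
    unfolding complex_norm_square[symmetric] q_def Re_sum_cnj_mult[symmetric] by simp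
  also have "\<dots> = (cmod b)\<^sup>2 / q"
    using q0 by (simp add: a_def norm_divide power_divide power2_eq_square)
  finally have 2: "(a *s x) \<bullet> (W *v (a *s x)) = (cmod b)\<^sup>2 / q" .
  have "0 \<le> (y - a *s x) \<bullet> (W *v (y - a *s x))" by (rule W)
  also have "\<dots> = y \<bullet> (W *v y) - 2 * (y \<bullet> (W *v (a *s x))) + (a *s x) \<bullet> (W *v (a *s x))"
    using hermitian_inner_matvec[OF W(1), of "a *s x" y]
    by (simp add: linear_diff[OF linear_matvec] inner_diff inner_diff_right inner_commute)
  also have "\<dots> = y \<bullet> (W *v y) - (cmod b)\<^sup>2 / q" using 1 2 by simp
  also have "\<dots> = y \<bullet> (?W' *v y)"
    using bb by (simp add: matrix_vector_mult_diff_rdistrib scaleR_matvec outer_matvec inner_diff_right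
        inner_smult cb b_def[symmetric] q_def[symmetric])
  finally show "0 \<le> y \<bullet> (?W' *v y)" .
qed

text \<open>Repeated deflation splits \<open>W\<close> into positive multiples of rank one matrices
  \<open>outer v\<close>, and each of these pairs with \<open>H\<close> to a value of the quadratic
  form of \<open>H\<close>. This takes the place of a spectral decomposition.\<close>

lemma psd_inner_nonneg:
  fixes H W :: "complex^'k^'k"
  assumes H: "psd H" and "psd W"
  shows "0 \<le> H \<bullet> W"
  using \<open>psd W\<close>
\<comment> \<open>The measure is the real rank of \<open>W\<close>; deflation keeps the kernel of
  \<open>W\<close> and adds \<open>x\<close> to it.\<close>
proof (induction "DIM(complex^'k) - dim {x. W *v x = 0}" arbitrary: W rule: less_induct)
  case (less W)
  show ?case
  proof (cases "\<forall>x. W *v x = 0")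
    case True
    then have "W = 0" by (metis matrix_eq matrix_vector_mult_0)
    then show ?thesis by simp
  next
    case False
    then obtain x where x: "W *v x \<noteq> 0" by blast
    define q where "q = x \<bullet> (W *v x)"
    have W: "hermitian W" "\<And>x. 0 \<le> x \<bullet> (W *v x)" using less.prems by (auto simp: psd_iff_inner)
    have q: "q > 0"
      using x psd_matvec_eq_0[OF less.prems, of x] W(2)[of x] by (force simp: q_def)
    define W' where "W' = W - (1 / q) *\<^sub>R outer (W *v x)"
    have psd: "psd W'"
      using psd_deflate[OF less.prems] q by (simp add: W'_def q_def)
    have W': "W' *v y = W *v y - (1 / q) *\<^sub>R ((\<Sum>i\<in>UNIV. cnj ((W *v x) $ i) * y $ i) *s (W *v x))" for y
      by (simp add: W'_def matrix_vector_mult_diff_rdistrib scaleR_matvec outer_matvec)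
    have herm: "(\<Sum>i\<in>UNIV. cnj ((W *v x) $ i) * y $ i) = (\<Sum>i\<in>UNIV. cnj (x $ i) * (W *v y) $ i)" for y
    proof -
      have "(\<Sum>i\<in>UNIV. cnj ((W *v x) $ i) * y $ i)
          = (\<Sum>i\<in>UNIV. \<Sum>j\<in>UNIV. cnj (W $ i $ j) * cnj (x $ j) * y $ i)"
        by (simp add: matrix_vector_mult_def sum_distrib_right)
      also have "\<dots> = (\<Sum>j\<in>UNIV. \<Sum>i\<in>UNIV. cnj (W $ i $ j) * cnj (x $ j) * y $ i)"
        by (rule sum.swap)
      also have "\<dots> = (\<Sum>i\<in>UNIV. cnj (x $ i) * (W *v y) $ i)"
        by (simp add: matrix_vector_mult_def sum_distrib_left hermitian_nth[OF W(1)] algebra_simps)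
      finally show ?thesis .
    qed
    have sub: "{x. W *v x = 0} \<subseteq> {x. W' *v x = 0}"
      by (auto simp: W' herm)
    \<comment> \<open>By definition \<open>q\<close> is only the real part of the complex
      coefficient in \<open>W' *v x\<close>; the imaginary part must vanish for
      \<open>W *v x\<close> to cancel completely.\<close>
    have "Im (\<Sum>i\<in>UNIV. cnj (x $ i) * (W *v x) $ i) = 0"
    proof -
      have "cnj (\<Sum>i\<in>UNIV. cnj (x $ i) * (W *v x) $ i) = (\<Sum>i\<in>UNIV. cnj ((W *v x) $ i) * x $ i)"
        by (simp add: mult.commute)
      then have "cnj (\<Sum>i\<in>UNIV. cnj (x $ i) * (W *v x) $ i) = (\<Sum>i\<in>UNIV. cnj (x $ i) * (W *v x) $ i)"
        using herm[of x] by simp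
      then show ?thesis by (metis Reals_cnj_iff complex_is_Real_iff)
    qed
    then have qq: "(\<Sum>i\<in>UNIV. cnj (x $ i) * (W *v x) $ i) = complex_of_real q"
      unfolding q_def Re_sum_cnj_mult[symmetric] by (simp add: complex_eq_iff)
    have "W' *v x = 0"
      unfolding W' herm qq of_real_smult using q by simp
    then have psub: "{x. W *v x = 0} \<subset> {x. W' *v x = 0}"
      using sub x by blast
    have ker: "subspace {x. A *v x = 0}" for A :: "complex^'k^'k"
      using linear_subspace_kernel[OF linear_matvec] .
    have "dim {x. W *v x = 0} < dim {x. W' *v x = 0}"
      using psub ker by (intro dim_psubset) (metis span_eq_iff)
    moreover have "dim {x. W' *v x = 0} \<le> DIM(complex^'k)" by (rule dim_subset_UNIV)
    ultimately have "0 \<le> H \<bullet> W'"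
      using psd by (intro less.hyps) linarith+
    moreover have "H \<bullet> W = H \<bullet> W' + (1 / q) * (H \<bullet> outer (W *v x))"
      by (simp add: W'_def inner_diff_right)
    moreover have "0 \<le> H \<bullet> outer (W *v x)"
      using H by (simp add: inner_outer psd_iff_inner)
    ultimately show ?thesis using q by simp
  qed
qed

section \<open>The largest eigenvalue of a Hermitian matrix\<close>

lemma inner_mat_1: "mat 1 \<bullet> W = Re (trace W)" for W :: "complex^'k^'k"
  using trace_inner_eq_inner[OF hermitian_mat_1, of W] by (simp add: trace_inner_def)

text \<open>Let \<open>v\<close> maximize the quadratic form on the unit sphere, with value
  \<open>l\<close>. Then \<open>l *\<^sub>R mat 1 - A\<close> is positive semidefinite and its form
  vanishes at \<open>v\<close>, so \<open>v\<close> is an eigenvector. The same bound dominates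
  every other real eigenvalue, so the \<open>GREATEST\<close> in \<open>lambda_max\<close> is
  attained.\<close>

lemma hermitian_lambda_max:
  fixes A :: "complex^'k^'k"
  assumes A: "hermitian A"
  shows "\<exists>v. v \<noteq> 0 \<and> A *v v = complex_of_real (lambda_max A) *s v"
    and "psd (lambda_max A *\<^sub>R mat 1 - A)"
proof -
  let ?S = "sphere (0 :: complex^'k) 1"
  have "continuous_on ?S (\<lambda>x. x \<bullet> (A *v x))"
    by (intro continuous_intros linear_continuous_on linear_conv_bounded_linear[THEN iffD1] linear_matvec)
  then obtain v where v: "v \<in> ?S" and max: "\<And>x. x \<in> ?S \<Longrightarrow> x \<bullet> (A *v x) \<le> v \<bullet> (A *v v)"
    using continuous_attains_sup[of ?S "\<lambda>x. x \<bullet> (A *v x)"] by auto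
  define l where "l = v \<bullet> (A *v v)"
  have bound: "x \<bullet> (A *v x) \<le> l * (x \<bullet> x)" for x
  proof (cases "x = 0")
    case False
    then have "(x /\<^sub>R norm x) \<bullet> (A *v (x /\<^sub>R norm x)) \<le> l"
      unfolding l_def by (intro max) simp
    then have "(x \<bullet> (A *v x)) / (norm x)\<^sup>2 \<le> l"
      by (simp add: matvec_scaleR power2_eq_square divide_inverse mult_ac)
    then show ?thesis using False
      by (simp add: divide_le_eq dot_square_norm)
  qed simp
  have mv: "(l *\<^sub>R mat 1 - A) *v x = l *\<^sub>R x - A *v x" for l x
    by (simp add: matrix_vector_mult_diff_rdistrib scaleR_matvec)
  have psd: "psd (l *\<^sub>R mat 1 - A)"
    unfolding psd_iff_inner mv using bound
    by (simp add: inner_diff_right hermitian_diff hermitian_scaleR hermitian_mat_1 A)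
  have "v \<bullet> ((l *\<^sub>R mat 1 - A) *v v) = 0"
    using v by (simp add: mv inner_diff_right l_def dot_square_norm)
  from psd_matvec_eq_0[OF psd this] have ev: "A *v v = complex_of_real l *s v"
    by (simp add: mv of_real_smult)
  have "lambda_max A = l"
    unfolding lambda_max_def
  proof (rule Greatest_equality)
    show "\<exists>v. v \<noteq> 0 \<and> A *v v = complex_of_real l *s v" using ev v by (auto intro!: exI[of _ v])
    fix k assume "\<exists>v. v \<noteq> 0 \<and> A *v v = complex_of_real k *s v"
    then obtain w where w: "w \<noteq> 0" "A *v w = k *\<^sub>R w" by (auto simp: of_real_smult)
    then have "k * (w \<bullet> w) \<le> l * (w \<bullet> w)" using bound[of w] by simp
    then show "k \<le> l" using w(1) by simp
  qed
  then show "\<exists>v. v \<noteq> 0 \<and> A *v v = complex_of_real (lambda_max A) *s v"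
    and "psd (lambda_max A *\<^sub>R mat 1 - A)"
    using ev v psd by (auto intro!: exI[of _ v])
qed

text \<open>One direction evaluates the form of \<open>A\<close> at an eigenvector of
  \<open>- A\<close>; the other writes \<open>A\<close> as a nonnegative multiple of the identity
  plus a positive semidefinite matrix. It identifies dual feasibility with a vanishing
  penalty.\<close>

lemma psd_iff_lambda_max_uminus:
  fixes A :: "complex^'k^'k"
  assumes A: "hermitian A"
  shows "psd A \<longleftrightarrow> lambda_max (- A) \<le> 0"
proof
  assume "psd A"
  obtain v where v: "v \<noteq> 0" "(- A) *v v = complex_of_real (lambda_max (- A)) *s v"
    using hermitian_lambda_max(1)[OF hermitian_uminus[OF A]] by blast
  have "(- A) *v v = - (A *v v)"
    by (simp add: matrix_vector_mult_def vec_eq_iff sum_negf)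
  then have "v \<bullet> (A *v v) = - lambda_max (- A) * (v \<bullet> v)"
    using arg_cong[OF v(2), of "\<lambda>w. v \<bullet> w"] by (simp add: of_real_smult)
  moreover have "0 \<le> v \<bullet> (A *v v)" using \<open>psd A\<close> by (simp add: psd_iff_inner)
  moreover have "v \<bullet> v > 0" using v by simp
  ultimately show "lambda_max (- A) \<le> 0" by (simp add: mult_le_0_iff)
next
  assume le: "lambda_max (- A) \<le> 0"
  have "psd (mat 1)" by (simp add: psd_iff_inner hermitian_mat_1)
  then have "psd ((- lambda_max (- A)) *\<^sub>R mat 1)" using le by (intro psd_scaleR) auto
  from psd_add[OF this hermitian_lambda_max(2)[OF hermitian_uminus[OF A]]]
  show "psd A" by simp
qed

text \<open>Pair \<open>W\<close> with the positive semidefinite matrix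
  \<open>lambda_max (- A) *\<^sub>R mat 1 + A\<close>; truncating at 0 only weakens the bound, since
  the trace of \<open>W\<close> is nonnegative. This trace becomes the threshold for
  \<alpha>.\<close>

lemma inner_psd_ge_lambda_max:
  assumes A: "hermitian A" and W: "psd W"
  shows "A \<bullet> W \<ge> - max (lambda_max (- A)) 0 * Re (trace W)"
proof -
  have "0 \<le> (lambda_max (- A) *\<^sub>R mat 1 - (- A)) \<bullet> W"
    by (intro psd_inner_nonneg hermitian_lambda_max hermitian_uminus A W)
  then have 1: "- lambda_max (- A) * Re (trace W) \<le> A \<bullet> W"
    by (simp add: inner_add_left inner_mat_1)
  have "psd (mat 1)" by (simp add: psd_iff_inner hermitian_mat_1)
  then have "0 \<le> mat 1 \<bullet> W" using W by (rule psd_inner_nonneg)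
  then have "0 \<le> Re (trace W)" by (simp only: inner_mat_1)
  then have "lambda_max (- A) * Re (trace W) \<le> max (lambda_max (- A)) 0 * Re (trace W)"
    by (intro mult_right_mono) auto
  with 1 show ?thesis by simp
qed

lemma closed_psd: "closed {W :: complex^'k^'k. psd W}"
proof -
  have "{W :: complex^'k^'k. psd W}
      = {W. conj_transpose W = W} \<inter> (\<Inter>x. {W. 0 \<le> W \<bullet> outer x})"
    by (auto simp: psd_iff_inner hermitian_def inner_outer)
  moreover have "closed {W :: complex^'k^'k. conj_transpose W = W}"
    by (intro closed_Collect_eq continuous_intros linear_continuous_on
        linear_conv_bounded_linear[THEN iffD1] linear_conj_transpose)
  moreover have "closed {W :: complex^'k^'k. 0 \<le> W \<bullet> outer x}" for x
    by (intro closed_Collect_le continuous_intros)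
  ultimately show ?thesis by (simp add: closed_Int closed_INT)
qed

section \<open>Closed cones\<close>

text \<open>On the compact set of unit vectors of \<open>S\<close> the map has no zero, so by
  homogeneity \<open>c * norm x \<le> norm (f x)\<close> on all of \<open>S\<close> for some
  \<open>c > 0\<close>. Preimages of a convergent sequence then stay in a ball, and the limit lies
  in the image of a compact part of \<open>S\<close>.\<close>

lemma closed_linear_image_cone:
  fixes f :: "'a::euclidean_space \<Rightarrow> 'b::real_normed_vector"
  assumes f: "linear f" and S: "closed S" "cone S"
    and ker: "\<And>x. x \<in> S \<Longrightarrow> f x = 0 \<Longrightarrow> x = 0"
  shows "closed (f ` S)"
proof -
  have cont: "continuous_on T f" for T
    using f by (simp add: linear_continuous_on linear_conv_bounded_linear)
  let ?K = "S \<inter> sphere 0 1"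
  have unit: "x /\<^sub>R norm x \<in> ?K" if "x \<in> S" "x \<noteq> 0" for x
    using that S(2) by (simp add: cone_def)
  obtain c where c: "c > 0" "\<And>x. x \<in> S \<Longrightarrow> c * norm x \<le> norm (f x)"
  proof (cases "?K = {}")
    case True
    then have "\<And>x. x \<in> S \<Longrightarrow> x = 0" using unit by blast
    then show thesis using that[of 1] by fastforce
  next
    case False
    moreover have "compact ?K" using S(1) by (simp add: closed_Int_compact)
    ultimately obtain a where a: "a \<in> ?K" "\<forall>x\<in>?K. norm (f a) \<le> norm (f x)"
      using continuous_attains_inf[of ?K "\<lambda>x. norm (f x)"] continuous_on_norm[OF cont] by blast
    have "norm (f a) > 0" using a(1) ker[of a] by auto
    moreover have "norm (f a) * norm x \<le> norm (f x)" if "x \<in> S" for x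
    proof (cases "x = 0")
      case False
      have "norm (f a) \<le> norm (f (x /\<^sub>R norm x))" using unit[OF that False] a(2) by blast
      also have "\<dots> = norm (f x) / norm x"
        by (simp add: linear_scale[OF f] divide_inverse mult.commute)
      finally show ?thesis using False by (simp add: pos_le_divide_eq)
    qed simp
    ultimately show thesis using that by blast
  qed
  show ?thesis
    unfolding closed_sequential_limits
  proof (intro allI impI, elim conjE)
    fix y l
    assume y: "\<forall>n. y n \<in> f ` S" and l: "y \<longlonglongrightarrow> l"
    obtain B where B: "\<And>n. norm (y n) \<le> B"
      using convergent_imp_bounded[OF l] by (auto simp: bounded_iff)
    let ?T = "f ` (S \<inter> cball 0 (B / c))"
    have "y n \<in> ?T" for n
    proof -
      obtain x where x: "x \<in> S" "y n = f x" using y by blast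
      have "c * norm x \<le> B" using c(2)[OF x(1)] B[of n] x(2) by simp
      then have "x \<in> cball 0 (B / c)" using c(1) by (simp add: field_simps)
      then show ?thesis using x by blast
    qed
    moreover have "compact ?T"
      using S(1) by (intro compact_continuous_image cont) (simp add: closed_Int_compact)
    ultimately have "l \<in> ?T"
      using l closed_sequentially compact_imp_closed by blast
    then show "l \<in> f ` S" by blast
  qed
qed

text \<open>A functional bounded below on a cone is nonnegative on it, so a separating hyperplane
  can be moved to level zero.\<close>

lemma separating_hyperplane_closed_convex_cone:
  fixes Q :: "'a::euclidean_space set"
  assumes Q: "convex_cone Q" "closed Q" and z: "z \<notin> Q"
  obtains a where "a \<bullet> z < 0" "\<And>x. x \<in> Q \<Longrightarrow> 0 \<le> a \<bullet> x"
proof -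
  have "convex Q" using Q(1) by (simp add: convex_cone_def)
  then obtain a b where ab: "a \<bullet> z < b" "\<forall>x\<in>Q. a \<bullet> x > b"
    using separating_hyperplane_closed_point[OF _ Q(2) z] by blast
  have b: "b < 0" using ab(2) convex_cone_contains_0[OF Q(1)] by force
  have "0 \<le> a \<bullet> x" if "x \<in> Q" for x
  proof (rule ccontr)
    assume neg: "\<not> 0 \<le> a \<bullet> x"
    \<comment> \<open>This multiple of \<open>x\<close> has the value exactly \<open>b\<close>,
      which strict separation excludes.\<close>
    have "(b / (a \<bullet> x)) *\<^sub>R x \<in> Q"
      using b neg that by (intro convex_cone_scaleR[OF Q(1)]) (auto simp: divide_nonpos_neg)
    with ab(2) have "a \<bullet> ((b / (a \<bullet> x)) *\<^sub>R x) > b" by blast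
    then show False using neg by simp
  qed
  then show thesis using ab(1) b that by force
qed

section \<open>Strong duality and exactness of the penalty\<close>

lemma linear_B_map: "linear (B_map s)"
  by (rule linearI) (simp_all add: B_map_def vec_eq_iff)

lemma hermitian_B_map: "hermitian W \<Longrightarrow> hermitian (B_map s W)"
  by (simp add: hermitian_def conj_transpose_def B_map_def vec_eq_iff)

lemma hermitian_C_mat: "hermitian (C_mat Y)"
  unfolding C_mat_def by (rule hermitian_part)

lemma hermitian_H_mat: "hermitian \<Gamma> \<Longrightarrow> hermitian (H_mat s Y y \<Gamma>)"
  unfolding H_mat_def by (intro hermitian_add hermitian_C_mat A_adj B_adj)

text \<open>Collects the adjoint identities: \<open>H_mat\<close> is the coefficient of
  \<open>W\<close> in the Lagrangian of the primal problem.\<close>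

lemma inner_H_mat:
  assumes G: "hermitian \<Gamma>" and W: "hermitian W"
  shows "H_mat s Y y \<Gamma> \<bullet> W = C_mat Y \<bullet> W + y \<bullet> A_map Y W + \<Gamma> \<bullet> B_map s W"
  using A_adj(2)[OF W, of Y y] B_adj(2)[OF G W, of s]
  by (simp add: H_mat_def inner_add_left trace_inner_eq_inner A_adj(1) B_adj(1)[OF G] G)

lemma phi_nonneg: "0 \<le> phi s Y x"
  by (simp add: phi_def split: prod.split)

lemma phi_eq_0_iff: "hermitian \<Gamma> \<Longrightarrow> phi s Y (y, \<Gamma>) = 0 \<longleftrightarrow> psd (H_mat s Y y \<Gamma>)"
  by (simp add: phi_def psd_iff_lambda_max_uminus hermitian_H_mat max_def)

section \<open>Strong duality and comparison with the penalized objective\<close>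

lemma one_inner_Basis: "b \<in> Basis \<Longrightarrow> (1 :: real^'a^'b) \<bullet> b = 1"
  by (auto simp: Basis_vec_def inner_axis)

lemma one_inner_eq_0:
  assumes "0 \<le> z" "1 \<bullet> z = 0"
  shows "z = (0 :: real^'a^'b)"
proof -
  have "(\<Sum>b\<in>Basis. z \<bullet> b) = 0"
    using assms(2) by (simp add: euclidean_inner[of 1 z] one_inner_Basis)
  moreover have "0 \<le> z \<bullet> b" if "b \<in> Basis" for b
    using assms(1) that by (intro inner_nonneg_nonneg) auto
  ultimately have "\<forall>b\<in>Basis. z \<bullet> b = 0"
    by (simp add: sum_nonneg_eq_0_iff)
  then show ?thesis by (simp only: euclidean_all_zero_iff)
qed

text \<open>The half of strong duality that weak duality does not give: the dual infimum is at most
  minus the primal value. Attainment is not claimed.\<close>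

lemma dual_value_approx:
  fixes Y :: "'n::finite cmat"
  assumes \<beta>: "\<beta> > 0" and e: "e > 0"
    and opt: "is_arg_min (primal_obj \<beta> Y) (primal_feasible s Y m) (W0, z0)"
    and uniq: "\<And>W z. is_arg_min (primal_obj \<beta> Y) (primal_feasible s Y m) (W, z) \<Longrightarrow> W = W0"
  shows "\<exists>y \<Gamma>. dual_feasible s \<beta> Y (y, \<Gamma>) \<and> dual_obj m (y, \<Gamma>) < e - primal_obj \<beta> Y (W0, z0)"
proof -
  define C where "C = C_mat Y"
  define p where "p = primal_obj \<beta> Y (W0, z0)"
  have obj: "primal_obj \<beta> Y (W, z) = \<beta> * (1 \<bullet> z) + C \<bullet> W" for W z
    by (simp add: primal_obj_def C_def trace_inner_eq_inner hermitian_C_mat)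
  have feas: "psd W0" "0 \<le> z0" "A_map Y W0 + m \<le> z0" "B_map s W0 = M1"
    using opt by (auto simp: is_arg_min_def primal_feasible_def)
  have least: "p \<le> primal_obj \<beta> Y (W, z)"
    if "psd W" "0 \<le> z" "A_map Y W + m \<le> z" "B_map s W = M1" for W z
    using opt that unfolding is_arg_min_def primal_feasible_def p_def by force
  define L :: "'n cmat \<times> 'n stack \<times> real \<times> 'n stack \<Rightarrow> real \<times> 'n stack \<times> (complex^3^3)"
    where "L = (\<lambda>(W, z, r, w). (C \<bullet> W + \<beta> * (1 \<bullet> z) + r, A_map Y W - z + w, B_map s W))"
  define S :: "('n cmat \<times> 'n stack \<times> real \<times> 'n stack) set"
    where "S = {W. psd W} \<times> {0..} \<times> {0..} \<times> {0..}"
  have L: "linear L"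
    by (rule linearI)
      (auto simp: L_def linear_add[OF linear_A_map] linear_add[OF linear_B_map]
        linear_scale[OF linear_A_map] linear_scale[OF linear_B_map] inner_add_right algebra_simps)
  have S: "convex_cone S"
    by (auto simp: convex_cone_iff S_def zero_prod_def psd_zero psd_add psd_scaleR scaleR_nonneg_nonneg)
  then have cone: "cone S" by (simp add: convex_cone_iff cone_def)
  have closed: "closed S"
    unfolding S_def by (intro closed_Times closed_psd closed_eucl_atLeast)
  \<comment> \<open>A kernel element of the cone is a direction along which the primal optimum could be moved.\<close>
  have ker: "x = 0" if "x \<in> S" "L x = 0" for x
  proof -
    obtain D z r w where x: "x = (D, z, r, w)" by (cases x)
    have D: "psd D" "0 \<le> z" "0 \<le> r" "0 \<le> w"
      using that(1) by (auto simp: S_def x)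
    have 0: "C \<bullet> D + \<beta> * (1 \<bullet> z) + r = 0" "A_map Y D - z + w = 0" "B_map s D = 0"
      using that(2) by (auto simp: L_def x zero_prod_def)
    have AD: "A_map Y D = z - w" using 0(2) by (simp add: algebra_simps)
    have "A_map Y (W0 + D) + m = (A_map Y W0 + m) + (z - w)"
      by (simp add: linear_add[OF linear_A_map] AD)
    also have "\<dots> \<le> z0 + z" using D(4) feas(3) by (intro add_mono) auto
    finally have "primal_feasible s Y m (W0 + D, z0 + z)"
      using feas D 0(3) by (simp add: primal_feasible_def psd_add linear_add[OF linear_B_map])
    moreover have "primal_obj \<beta> Y (W0 + D, z0 + z) \<le> p"
      using 0(1) D(3) by (simp add: obj p_def inner_add_right algebra_simps)
    ultimately have "is_arg_min (primal_obj \<beta> Y) (primal_feasible s Y m) (W0 + D, z0 + z)"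
      using opt unfolding is_arg_min_def p_def by fastforce
    from uniq[OF this] have D0: "D = 0" by simp
    \<comment> \<open>Uniqueness concerns only the matrix component. The remaining ones vanish
      because \<beta> is positive and the objective equation has nonnegative terms only.\<close>
    have 1: "0 \<le> 1 \<bullet> z" using D(2) by (intro inner_nonneg_nonneg) (simp_all add: less_eq_vec_def)
    then have "0 \<le> \<beta> * (1 \<bullet> z)" using \<beta> by simp
    moreover have "\<beta> * (1 \<bullet> z) + r = 0" using 0(1) D0 by simp
    ultimately have "r = 0" "\<beta> * (1 \<bullet> z) = 0" using D(3) by linarith+
    then have "1 \<bullet> z = 0" using \<beta> by simp
    then have "z = 0" using D(2) by (intro one_inner_eq_0) auto
    moreover have "w = 0" using AD D0 \<open>z = 0\<close> by (simp add: linear_0[OF linear_A_map])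
    ultimately show ?thesis using D0 \<open>r = 0\<close> by (simp add: x zero_prod_def)
  qed
  have "(p - e, - m, M1) \<notin> L ` S"
  proof
    assume "(p - e, - m, M1) \<in> L ` S"
    then obtain W z r w where W: "psd W" "0 \<le> z" "0 \<le> r" "0 \<le> w"
      and eq: "p - e = C \<bullet> W + \<beta> * (1 \<bullet> z) + r" "- m = A_map Y W - z + w" "M1 = B_map s W"
      by (auto simp: S_def L_def)
    have "A_map Y W + m = z - w" using eq(2) by (simp add: algebra_simps)
    also have "\<dots> \<le> z" using W(4) by simp
    finally have "p \<le> primal_obj \<beta> Y (W, z)" using W eq(3) by (intro least) auto
    then show False using eq(1) e W(3) by (simp add: obj)
  qed
  moreover have "convex_cone (L ` S)" using S L by (simp add: convex_cone_linear_image)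
  moreover have "closed (L ` S)" using closed_linear_image_cone[OF L closed cone ker] .
  ultimately obtain a where a: "a \<bullet> (p - e, - m, M1) < 0" "\<And>x. x \<in> L ` S \<Longrightarrow> 0 \<le> a \<bullet> x"
    using separating_hyperplane_closed_convex_cone by blast
  obtain t y G where tyG: "a = (t, y, G)" by (cases a)
  have neg: "t * (p - e) - y \<bullet> m + G \<bullet> M1 < 0"
    using a(1) by (simp add: tyG inner_Pair)
  have nonneg: "0 \<le> t * (C \<bullet> W + \<beta> * (1 \<bullet> z) + r) + (y \<bullet> (A_map Y W - z + w) + G \<bullet> B_map s W)"
    if "psd W" "0 \<le> z" "0 \<le> r" "0 \<le> w" for W z r w
  proof -
    have "L (W, z, r, w) \<in> L ` S" using that by (auto simp: S_def)
    from a(2)[OF this] show ?thesis by (simp add: tyG L_def inner_Pair)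
  qed
  have A0: "A_map Y 0 = 0" and B0: "B_map s 0 = 0"
    by (simp_all add: linear_0[OF linear_A_map] linear_0[OF linear_B_map])
  \<comment> \<open>The signs of the multipliers come from testing \<open>nonneg\<close> on
    generators of the cone: \<open>r = 1\<close> here, then a unit vector for \<open>w\<close> gives
    \<open>0 \<le> y\<close>, and one for \<open>z\<close> gives the upper bound.\<close>
  have t: "0 \<le> t" using nonneg[of 0 0 1 0] by (simp add: A0 B0 psd_zero)
  have y0: "0 \<le> y"
    unfolding eucl_le[where 'a = "'n stack"]
  proof
    fix b :: "'n stack" assume "b \<in> Basis"
    then show "0 \<bullet> b \<le> y \<bullet> b" using nonneg[of 0 0 0 b] by (simp add: A0 B0 psd_zero)
  qed
  have y1: "y \<le> (t * \<beta>) *\<^sub>R 1"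
    unfolding eucl_le[where 'a = "'n stack"]
  proof
    fix b :: "'n stack" assume "b \<in> Basis"
    then show "y \<bullet> b \<le> ((t * \<beta>) *\<^sub>R 1) \<bullet> b"
      using nonneg[of 0 b 0 0] by (simp add: A0 B0 psd_zero one_inner_Basis)
  qed
  \<comment> \<open>A vertical hyperplane would have \<open>y = 0\<close> by the two bounds, and
    evaluation at the feasible \<open>W0\<close> would give \<open>0 \<le> G \<bullet> M1\<close>,
    against \<open>neg\<close>.\<close>
  have "t \<noteq> 0"
  proof
    assume "t = 0"
    then have "y = 0" using y0 y1 by simp
    then show False
      using nonneg[OF feas(1), of 0 0 0] neg \<open>t = 0\<close> by (simp add: feas(4))
  qed
  with t have t: "t > 0" by simp
  define y' where "y' = (1 / t) *\<^sub>R y"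
  \<comment> \<open>Division by \<open>t\<close> normalizes the weight of the objective to 1.
    Separation gives an arbitrary complex matrix \<open>G\<close>, hence the Hermitian part.\<close>
  define \<Gamma> where "\<Gamma> = (1 / t) *\<^sub>R ((1/2) *\<^sub>R (G + conj_transpose G))"
  have G: "hermitian \<Gamma>" unfolding \<Gamma>_def by (intro hermitian_scaleR hermitian_part)
  have GB: "\<Gamma> \<bullet> X = (G \<bullet> X) / t" if "hermitian X" for X
    using inner_hermitian_part[OF that, of G] by (simp add: \<Gamma>_def)
  have "psd (H_mat s Y y' \<Gamma>)"
    unfolding psd_iff_inner
  proof (intro conjI allI hermitian_H_mat G)
    fix x
    have "0 \<le> (t * (C \<bullet> outer x) + (y \<bullet> A_map Y (outer x) + G \<bullet> B_map s (outer x))) / t"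
      using nonneg[OF psd_outer, of 0 0 0 x] t by simp
    also have "\<dots> = H_mat s Y y' \<Gamma> \<bullet> outer x"
      using t by (simp add: inner_H_mat[OF G hermitian_outer] GB hermitian_B_map hermitian_outer
          y'_def C_def add_divide_distrib)
    finally show "0 \<le> x \<bullet> (H_mat s Y y' \<Gamma> *v x)" by (simp add: inner_outer)
  qed
  moreover have "0 \<le> y'" using y0 t by (simp add: y'_def scaleR_nonneg_nonneg)
  moreover have "y' \<le> \<beta> *\<^sub>R 1"
    using scaleR_left_mono[OF y1, of "1 / t"] t by (simp add: y'_def)
  ultimately have "dual_feasible s \<beta> Y (y', \<Gamma>)" using G by (simp add: dual_feasible_def)
  moreover have "dual_obj m (y', \<Gamma>) < e - p"
  proof -
    have "hermitian M1" by (simp add: M1_def hermitian_outer)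
    then have "dual_obj m (y', \<Gamma>) = (G \<bullet> M1 - y \<bullet> m) / t"
      by (simp add: dual_obj_def trace_inner_eq_inner G GB y'_def inner_commute[of m] diff_divide_distrib)
    also have "\<dots> < e - p"
      unfolding pos_divide_less_eq[OF t] using neg by (simp add: algebra_simps)
    finally show ?thesis .
  qed
  ultimately show ?thesis unfolding p_def by blast
qed

text \<open>Weak duality with an error term: where \<open>H_mat\<close> fails to be positive
  semidefinite, its pairing with \<open>W0\<close> loses at most \<open>phi\<close> times the trace
  of \<open>W0\<close>. The other two products, of \<open>y\<close> with the constraint slack and of
  its distance to the upper bound with \<open>z0\<close>, are nonnegative.\<close>

lemma penalized_obj_ge:
  fixes Y :: "'n::finite cmat"
  assumes feas: "primal_feasible s Y m (W0, z0)" and X: "(y, \<Gamma>) \<in> X_set \<beta>"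
  shows "penalized_obj s Y m \<alpha> (y, \<Gamma>)
    \<ge> - primal_obj \<beta> Y (W0, z0) + (\<alpha> - Re (trace W0)) * phi s Y (y, \<Gamma>)"
proof -
  have W: "psd W0" "0 \<le> z0" "A_map Y W0 + m \<le> z0" "B_map s W0 = M1"
    using feas by (auto simp: primal_feasible_def)
  have y: "hermitian \<Gamma>" "0 \<le> y" "y \<le> \<beta> *\<^sub>R 1" using X by (auto simp: X_set_def)
  have herm: "hermitian W0" using W(1) by (simp add: psd_iff_inner)
  have "0 \<le> y \<bullet> (z0 - (A_map Y W0 + m))"
    using y(2) W(3) by (intro inner_nonneg_nonneg) auto
  moreover have "0 \<le> (\<beta> *\<^sub>R 1 - y) \<bullet> z0"
    using y(3) W(2) by (intro inner_nonneg_nonneg) auto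
  ultimately have "y \<bullet> A_map Y W0 + y \<bullet> m \<le> \<beta> * (1 \<bullet> z0)"
    by (simp add: inner_diff_left inner_diff_right inner_add_right)
  moreover have "- phi s Y (y, \<Gamma>) * Re (trace W0) \<le> H_mat s Y y \<Gamma> \<bullet> W0"
    using inner_psd_ge_lambda_max[OF hermitian_H_mat[OF y(1)] W(1), of s Y y] by (simp add: phi_def)
  moreover have "H_mat s Y y \<Gamma> \<bullet> W0 = C_mat Y \<bullet> W0 + y \<bullet> A_map Y W0 + \<Gamma> \<bullet> M1"
    using inner_H_mat[OF y(1) herm] W(4) by simp
  ultimately show ?thesis
    by (simp add: penalized_obj_def primal_obj_def trace_inner_eq_inner hermitian_C_mat y(1)
        inner_commute[of m] algebra_simps)
qed

theorem proposition1:
  fixes s :: "'n::finite"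
    and \<beta> \<alpha> :: real
    and Y W_opt :: "complex^('n \<times> 3)^('n \<times> 3)"
    and u p_max p_min q_max q_min v_max v_min :: "real^('n \<times> 3)"
  assumes "\<beta> > 0"
    and "unique_primal_solution s \<beta> Y (m_vec p_max p_min q_max q_min v_max v_min u) W_opt"
    and "\<alpha> > Re (trace W_opt)"
  shows "{(y, \<Gamma>). is_arg_min (dual_obj (m_vec p_max p_min q_max q_min v_max v_min u))
            (dual_feasible s \<beta> Y) (y, \<Gamma>)} =
         {(y, \<Gamma>). is_arg_min (penalized_obj s Y (m_vec p_max p_min q_max q_min v_max v_min u) \<alpha>)
            (\<lambda>x. x \<in> X_set \<beta>) (y, \<Gamma>)}"
proof -
  define m where "m = m_vec p_max p_min q_max q_min v_max v_min u"
  obtain z where opt: "is_arg_min (primal_obj \<beta> Y) (primal_feasible s Y m) (W_opt, z)"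
    and uniq: "\<And>W z. is_arg_min (primal_obj \<beta> Y) (primal_feasible s Y m) (W, z) \<Longrightarrow> W = W_opt"
    using assms(2) unfolding unique_primal_solution_def m_def by blast
  define p where "p = primal_obj \<beta> Y (W_opt, z)"
  have feas: "primal_feasible s Y m (W_opt, z)" using opt by (simp add: is_arg_min_def)
  let ?f = "penalized_obj s Y m \<alpha>" and ?d = "dual_obj m"
  have lower: "- p + (\<alpha> - Re (trace W_opt)) * phi s Y x \<le> ?f x" if "x \<in> X_set \<beta>" for x
    using penalized_obj_ge[OF feas, of "fst x" "snd x" \<beta> \<alpha>] that by (simp add: p_def)
  have lower': "- p \<le> ?f x" if "x \<in> X_set \<beta>" for x
    using lower[OF that] mult_nonneg_nonneg[of "\<alpha> - Re (trace W_opt)" "phi s Y x"]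
      phi_nonneg[of s Y x] assms(3) by linarith
  have dual: "x \<in> X_set \<beta>" "?f x = ?d x" if "dual_feasible s \<beta> Y x" for x
    using that by (auto simp: dual_feasible_def X_set_def penalized_obj_def dual_obj_def phi_eq_0_iff
        split: prod.splits)
  have dual': "dual_feasible s \<beta> Y x" if "x \<in> X_set \<beta>" "phi s Y x = 0" for x
    using that by (auto simp: dual_feasible_def X_set_def phi_eq_0_iff)
  \<comment> \<open>Only the infimum of the dual is known. The two sets are compared point by point,
    which also covers the case that both are empty.\<close>
  have approx: "\<exists>x. dual_feasible s \<beta> Y x \<and> ?d x < v" if "- p < v" for v
    using dual_value_approx[OF assms(1) _ opt uniq, of "v + p"] that unfolding p_def by force
  have "is_arg_min ?d (dual_feasible s \<beta> Y) x \<longleftrightarrow> is_arg_min ?f (\<lambda>x. x \<in> X_set \<beta>) x" for x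
  proof
    assume x: "is_arg_min ?d (dual_feasible s \<beta> Y) x"
    then have xf: "dual_feasible s \<beta> Y x" by (simp add: is_arg_min_def)
    have "?d x \<le> - p" using x approx[of "?d x"] unfolding is_arg_min_def by force
    then show "is_arg_min ?f (\<lambda>x. x \<in> X_set \<beta>) x"
      using dual[OF xf] lower' unfolding is_arg_min_def by force
  next
    assume x: "is_arg_min ?f (\<lambda>x. x \<in> X_set \<beta>) x"
    then have xX: "x \<in> X_set \<beta>" by (simp add: is_arg_min_def)
    \<comment> \<open>Dual feasible points lie in \<open>X_set\<close> and have the same value under
      both objectives, so \<open>approx\<close> also yields points below any value of
      \<open>?f\<close> above \<open>- p\<close>. With \<open>lower\<close>, the strict inequality
      for \<alpha> then leaves no room for a positive penalty.\<close>
    have "?f x \<le> - p" using x approx[of "?f x"] dual unfolding is_arg_min_def by force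
    then have "(\<alpha> - Re (trace W_opt)) * phi s Y x \<le> 0" using lower[OF xX] by simp
    then have "phi s Y x = 0"
      using assms(3) phi_nonneg[of s Y x] by (simp add: mult_le_0_iff)
    then have xf: "dual_feasible s \<beta> Y x" using dual'[OF xX] by blast
    have "\<not> ?d y < ?d x" if "dual_feasible s \<beta> Y y" for y
      using x dual[OF that] dual(2)[OF xf] unfolding is_arg_min_def by metis
    with xf show "is_arg_min ?d (dual_feasible s \<beta> Y) x"
      unfolding is_arg_min_def by blast
  qed
  then show ?thesis unfolding m_def by simp
qed

end
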